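(* Let $d\ge7$, let $A,B$ be linearly independent binary forms of order $d$ over $\mathbf{C}$, and put $T_i=(A,B)_i$. Define $$\beta_1=-\frac{8(2d-5)(2d-7)(2d-3)}{d(d-1)(4d-13)},\quad \beta_2=-\frac{60(2d-7)(2d-5)}{d(d-1)(4d-13)},\quad \beta_3=\frac{12(2d-3)(d-5)}{d(4d-13)},$$ $$\beta_4=\frac{20(2d-5)(2d-7)(d-3)}{(d-1)(4d-13)(2d-3)},\quad \beta_5=1,\quad \beta_6=\frac{(d-5)(d-6)(2d-3)(2d-5)}{d(d-1)(2d-9)(2d-11)}.$$ Then $$T_7=\frac{1}{T_1}\left(\frac{\beta_1}{\beta_6}(T_1,T_1)_6+\frac{\beta_2}{\beta_6}(T_1,T_3)_4+\frac{\beta_3}{\beta_6}(T_1,T_5)_2+\frac{\beta_4}{\beta_6}(T_3,T_3)_2+\frac{\beta_5}{\beta_6}T_3T_5\right).$$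
   Context: A form of order $e$ is a homogeneous polynomial of degree $e$ in $(x_0,x_1)$ over $\mathbf{C}$. For forms $E,F$ of orders $e,f$ and $0\le r\le\min\{e,f\}$, the $r$-th transvectant is $$(E,F)_r=\frac{(e-r)!(f-r)!}{e!f!}\sum_{i=0}^r(-1)^i\binom{r}{i}\frac{\partial^rE}{\partial x_0^{r-i}\partial x_1^i}\,\frac{\partial^rF}{\partial x_0^i\partial x_1^{r-i}},$$ a form of order $e+f-2r$, and $(E,F)_r=0$ for $r>\min\{e,f\}$. Since $A,B$ are linearly independent, $T_1\neq0$; the identity is in the field of rational functions $\mathbf{C}(x_0,x_1)$. *)

theory Defs
  imports Complex_Main
    "HOL-Computational_Algebra.Polynomial_Factorial"
begin

text \<open>
  Polynomials in two variables \<open>x0\<close>, \<open>x1\<close> over the complex numbers are the elements of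
  \<open>complex poly poly\<close>: the inner variable is \<open>x0\<close>, the outer one is \<open>x1\<close>, so that
  \<open>coeff (coeff F j) i\<close> is the coefficient of \<open>x0^i * x1^j\<close> in \<open>F\<close>.
\<close>

type_synonym bipoly = "complex poly poly"

text \<open>The zero polynomial is a form of every order.\<close>

definition binary_form :: "nat \<Rightarrow> bipoly \<Rightarrow> bool" where
  "binary_form e F \<longleftrightarrow> (\<forall>i j. coeff (coeff F j) i \<noteq> 0 \<longrightarrow> i + j = e)"

definition cscale :: "complex \<Rightarrow> bipoly \<Rightarrow> bipoly" where
  "cscale c F = smult [:c:] F"

text \<open>Linear independence over the complex numbers of the pair \<open>(A, B)\<close>, not of the set
  \<open>{A, B}\<close>; in particular it forces \<open>A \<noteq> B\<close>.\<close>

definition lin_indep_pair :: "bipoly \<Rightarrow> bipoly \<Rightarrow> bool" where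
  "lin_indep_pair A B \<longleftrightarrow> (\<forall>a b. cscale a A + cscale b B = 0 \<longrightarrow> a = 0 \<and> b = 0)"

definition pd0 :: "bipoly \<Rightarrow> bipoly" where
  "pd0 F = map_poly pderiv F"

definition pd1 :: "bipoly \<Rightarrow> bipoly" where
  "pd1 F = pderiv F"

text \<open>
  \<open>transvectant e f r E F\<close> is the \<open>r\<close>-th transvectant of \<open>E\<close> and \<open>F\<close>, regarded as forms of
  orders \<open>e\<close> and \<open>f\<close>. The orders are arguments because the zero form does not determine its order.
\<close>

definition transvectant :: "nat \<Rightarrow> nat \<Rightarrow> nat \<Rightarrow> bipoly \<Rightarrow> bipoly \<Rightarrow> bipoly" where
  "transvectant e f r E F =
    (if r \<le> min e f then
       cscale (fact (e - r) * fact (f - r) / (fact e * fact f))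
         (\<Sum>i\<le>r. cscale ((-1) ^ i * of_nat (r choose i))
            ((pd0 ^^ (r - i)) ((pd1 ^^ i) E) * (pd0 ^^ i) ((pd1 ^^ (r - i)) F)))
     else 0)"

lemma coeff_cscale: "coeff (coeff (cscale c F) j) i = c * coeff (coeff F j) i"
  by (simp add: cscale_def)

lemma coeff_pd0: "coeff (coeff (pd0 F) j) i = of_nat (Suc i) * coeff (coeff F j) (Suc i)"
  by (simp add: pd0_def coeff_map_poly coeff_pderiv)

lemma coeff_pd1: "coeff (coeff (pd1 F) j) i = of_nat (Suc j) * coeff (coeff F (Suc j)) i"
  by (simp add: pd1_def coeff_pderiv of_nat_poly)

text \<open>The field of rational functions in \<open>x0\<close>, \<open>x1\<close> is \<open>bipoly fract\<close>, and \<open>to_fract\<close> is the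
  embedding of the polynomials.\<close>

definition const_fract :: "complex \<Rightarrow> bipoly fract" where
  "const_fract c = to_fract [:[:c:]:]"

text \<open>The constants are functions of a complex argument, so that subtraction is not truncated;
  they are used at \<open>of_nat d\<close>.\<close>

definition beta1 :: "complex \<Rightarrow> complex" where
  "beta1 d = - (8 * (2*d - 5) * (2*d - 7) * (2*d - 3) / (d * (d - 1) * (4*d - 13)))"

definition beta2 :: "complex \<Rightarrow> complex" where
  "beta2 d = - (60 * (2*d - 7) * (2*d - 5) / (d * (d - 1) * (4*d - 13)))"

definition beta3 :: "complex \<Rightarrow> complex" where
  "beta3 d = 12 * (2*d - 3) * (d - 5) / (d * (4*d - 13))"

definition beta4 :: "complex \<Rightarrow> complex" where
  "beta4 d = 20 * (2*d - 5) * (2*d - 7) * (d - 3) / ((d - 1) * (4*d - 13) * (2*d - 3))"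

definition beta5 :: "complex \<Rightarrow> complex" where
  "beta5 d = 1"

definition beta6 :: "complex \<Rightarrow> complex" where
  "beta6 d = (d - 5) * (d - 6) * (2*d - 3) * (2*d - 5) / (d * (d - 1) * (2*d - 9) * (2*d - 11))"

end

theory Submission
  imports Defs
begin

text \<open>
  Write \<open>D\<close> for the derivative in \<open>x0\<close>, and for a form \<open>F\<close> of order \<open>e\<close> let
  \<open>F[k] = (e - k)! / e! * D^k F\<close>. Euler's relation \<open>x0 * pd0 F + x1 * pd1 F = e * F\<close> trades
  derivatives in \<open>x1\<close> for derivatives in \<open>x0\<close>, and in a transvectant the powers of \<open>x0\<close> that
  appear on the way cancel. What is left is Cayley's formula (\<open>X1_pow_transvectant\<close>)

    \<open>x1^r * (E,F)_r = (\<Sum>k\<le>r. (-1)^k * (r choose k) * E[r-k] * F[k])\<close>.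

  For the two given forms this makes \<open>x1^r * T_r\<close>, with \<open>r\<close> odd, a combination with constant
  coefficients of the brackets \<open>p i j = A[i] * B[j] - A[j] * B[i]\<close>. Because \<open>D x1 = 0\<close> and
  \<open>D (p i j) = (d-i) * p (i+1) j + (d-j) * p i (j+1)\<close>, the normalised derivatives of
  \<open>T_1\<close>, \<open>T_3\<close>, \<open>T_5\<close>, multiplied by the same powers of \<open>x1\<close>, are combinations of brackets as
  well, whose coefficients are rational functions of \<open>d\<close>. A second use of Cayley's formula does
  the same for the transvectants of the \<open>T_r\<close>, with products of two brackets.

  The claimed identity, multiplied by \<open>x1^8\<close>, thereby becomes a relation between products
  \<open>p i j * p k l\<close> with \<open>i + j + k + l = 8\<close>. There are only two independent Pluecker relations of
  this weight, on the indices \<open>0,1,2,5\<close> and \<open>0,1,3,4\<close>, and the identity is a combination of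
  them, with coefficients polynomial in \<open>d\<close> once denominators are cleared (\<open>bracket_identity\<close>).

  Finally \<open>T_1\<close> is, up to a nonzero constant, the Jacobian of \<open>A\<close> and \<open>B\<close>. If it vanished, so
  would the Wronskian in \<open>x1\<close> of any two combinations of \<open>A\<close> and \<open>B\<close>; nonzero
  polynomials with vanishing Wronskian have equal degrees, but some nontrivial combination of \<open>A\<close> and \<open>B\<close> has smaller degree
  in \<open>x1\<close> than \<open>B\<close> (\<open>wronskian_nonzero\<close>).
\<close>

section \<open>Polynomials in two variables\<close>

text \<open>Identities that divide by constants are checked at all points of the plane, where the
  constants and the values of the polynomials lie in the same field.\<close>

definition ev :: "complex \<Rightarrow> complex \<Rightarrow> bipoly \<Rightarrow> complex" where
  "ev x y F = poly (poly F [:y:]) x"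

lemma ev_ring [simp]:
  "ev x y 0 = 0" "ev x y 1 = 1" "ev x y (F + G) = ev x y F + ev x y G"
  "ev x y (F - G) = ev x y F - ev x y G" "ev x y (- F) = - ev x y F"
  "ev x y (F * G) = ev x y F * ev x y G"
  "ev x y (F ^ n) = ev x y F ^ n" "ev x y (numeral k) = numeral k" "ev x y (of_nat m) = of_nat m"
  by (simp_all add: ev_def of_nat_poly numeral_poly)

lemma ev_sum [simp]: "ev x y (\<Sum>i\<in>I. f i) = (\<Sum>i\<in>I. ev x y (f i))"
  by (simp add: ev_def poly_sum)

lemma ev_cscale [simp]: "ev x y (cscale c F) = c * ev x y F"
  by (simp add: ev_def cscale_def)

lemma bipoly_eqI_ev:
  assumes "\<And>x y. ev x y F = ev x y G"
  shows "F = G"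
proof -
  have "poly (F - G) [:y:] = 0" for y
    using assms by (simp add: ev_def poly_eq_poly_eq_iff[symmetric] fun_eq_iff)
  then have "range (\<lambda>y. [:y:]) \<subseteq> {p. poly (F - G) p = 0}"
    by auto
  moreover have "infinite (range (\<lambda>y::complex. [:y:]))"
    using finite_imageD[of "\<lambda>y. [:y:]" "UNIV :: complex set"] infinite_UNIV_char_0
    by (auto simp: inj_on_def)
  ultimately have "infinite {p. poly (F - G) p = 0}"
    using finite_subset by blast
  then show ?thesis
    using poly_roots_finite[of "F - G"] by auto
qed

definition X0 :: bipoly where "X0 = [:[:0, 1:]:]"
definition X1 :: bipoly where "X1 = [:0, 1:]"

lemma X1_nonzero: "X1 \<noteq> 0"
  by (simp add: X1_def)

lemma pd_linear [simp]:
  "pd0 0 = 0" "pd0 (F + G) = pd0 F + pd0 G" "pd0 (F - G) = pd0 F - pd0 G"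
  "pd0 (cscale c F) = cscale c (pd0 F)"
  "pd1 (F + G) = pd1 F + pd1 G"
  "pd1 (cscale c F) = cscale c (pd1 F)"
  by (rule poly_eqI, rule poly_eqI, simp add: coeff_pd0 coeff_pd1 coeff_cscale algebra_simps)+

lemma cscale_simps [simp]: "cscale 0 F = 0" "cscale 1 F = F" "cscale c 0 = 0"
  "cscale a (cscale b F) = cscale (a * b) F"
  by (simp_all add: cscale_def mult.commute flip: one_pCons)

lemma cscale_mult: "F * cscale c G = cscale c (F * G)" "cscale c F * G = cscale c (F * G)"
  by (simp_all add: cscale_def)

lemma cscale_of_nat [simp]: "cscale (of_nat n) F = of_nat n * F"
  by (rule bipoly_eqI_ev) simp

lemma pd0_mult: "pd0 (F * G) = pd0 F * G + F * pd0 G"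
proof (rule poly_eqI)
  fix n
  have *: "pderiv (\<Sum>i\<in>I. f i) = (\<Sum>i\<in>I. pderiv (f i))" for I and f :: "nat \<Rightarrow> complex poly"
    by (induction I rule: infinite_finite_induct) (simp_all add: pderiv_add)
  have "coeff (pd0 H) k = pderiv (coeff H k)" for H k
    by (simp add: pd0_def coeff_map_poly)
  then show "coeff (pd0 (F * G)) n = coeff (pd0 F * G + F * pd0 G) n"
    by (simp only: coeff_add coeff_mult * pderiv_mult sum.distrib[symmetric])
       (simp add: add.commute mult.commute)
qed

lemma pd1_mult: "pd1 (F * G) = pd1 F * G + F * pd1 G"
  by (simp add: pd1_def pderiv_mult algebra_simps)

lemma pd0_consts [simp]: "pd0 1 = 0" "pd0 (of_nat n) = 0" "pd0 (numeral k) = 0"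
proof -
  show *: "pd0 (of_nat n) = 0" for n
    by (rule poly_eqI) (simp add: pd0_def coeff_map_poly of_nat_poly coeff_pCons pderiv_pCons split: nat.split)
  show "pd0 1 = 0" "pd0 (numeral k) = 0" using *[of 1] *[of "numeral k"] by simp_all
qed

lemma pd0_X1 [simp]: "pd0 X1 = 0"
  by (rule poly_eqI) (simp add: pd0_def coeff_map_poly X1_def coeff_pCons pderiv_pCons one_pCons split: nat.split)

lemma pd0_X1_power [simp]: "pd0 (X1 ^ n) = 0"
  by (induction n) (simp_all add: pd0_mult)

lemma pd_commute: "pd0 (pd1 F) = pd1 (pd0 F)"
  by (rule poly_eqI, rule poly_eqI) (simp add: coeff_pd0 coeff_pd1)

lemma pd0_pow_pd1: "(pd0 ^^ n) (pd1 F) = pd1 ((pd0 ^^ n) F)"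
  by (induction n) (simp_all add: pd_commute)

lemma pd1_pow_pd0: "(pd1 ^^ n) (pd0 F) = pd0 ((pd1 ^^ n) F)"
  by (induction n) (simp_all add: pd_commute)

section \<open>Forms\<close>

text \<open>Euler's relation characterises forms because the operator on the left multiplies the
  monomial \<open>x0^i * x1^j\<close> by \<open>i + j\<close>, and natural numbers are distinct in characteristic zero.
  Being a derivation, the operator makes closure under products immediate.\<close>

lemma binary_form_iff_euler:
  "binary_form e F \<longleftrightarrow> X0 * pd0 F + X1 * pd1 F = of_nat e * F"
proof -
  have "coeff (coeff (X0 * pd0 F + X1 * pd1 F) j) i = of_nat (i + j) * coeff (coeff F j) i" for i j
    by (cases i; cases j)
       (simp_all add: X0_def X1_def coeff_pCons coeff_pd0 coeff_pd1 algebra_simps)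
  moreover have "coeff (coeff (of_nat e * F) j) i = of_nat e * coeff (coeff F j) i" for i j
    by (metis coeff_cscale cscale_of_nat)
  ultimately have "X0 * pd0 F + X1 * pd1 F = of_nat e * F \<longleftrightarrow>
      (\<forall>i j. of_nat (i + j) * coeff (coeff F j) i = of_nat e * coeff (coeff F j) i)"
    by (auto simp: poly_eq_iff)
  then show ?thesis
    by (auto simp: binary_form_def simp del: of_nat_add)
qed

lemma binary_form_pd0: "binary_form e F \<Longrightarrow> binary_form (e - 1) (pd0 F)"
  unfolding binary_form_def coeff_pd0 by (metis add_Suc diff_Suc_1 mult_eq_0_iff)

lemma binary_form_pd1: "binary_form e F \<Longrightarrow> binary_form (e - 1) (pd1 F)"
  unfolding binary_form_def coeff_pd1 by (metis add_Suc_right diff_Suc_1 mult_eq_0_iff)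

lemma binary_form_pd0_pow: "binary_form e F \<Longrightarrow> binary_form (e - n) ((pd0 ^^ n) F)"
proof (induction n)
  case (Suc n)
  then show ?case using binary_form_pd0[of "e - n"] by simp
qed simp

lemma binary_form_pd1_pow: "binary_form e F \<Longrightarrow> binary_form (e - n) ((pd1 ^^ n) F)"
proof (induction n)
  case (Suc n)
  then show ?case using binary_form_pd1[of "e - n"] by simp
qed simp

lemma binary_form_0: "binary_form e 0"
  by (simp add: binary_form_def)

lemma binary_form_add: "binary_form e F \<Longrightarrow> binary_form e G \<Longrightarrow> binary_form e (F + G)"
  unfolding binary_form_def by (metis add.left_neutral coeff_add)

lemma binary_form_cscale: "binary_form e F \<Longrightarrow> binary_form e (cscale c F)"
  by (simp add: binary_form_def coeff_cscale)

lemma binary_form_sum: "(\<And>i. i \<in> I \<Longrightarrow> binary_form e (f i)) \<Longrightarrow> binary_form e (\<Sum>i\<in>I. f i)"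
  by (induction I rule: infinite_finite_induct) (auto intro: binary_form_add binary_form_0)

lemma binary_form_mult:
  assumes "binary_form e F" "binary_form f G"
  shows "binary_form (e + f) (F * G)"
proof -
  have "X0 * pd0 (F * G) + X1 * pd1 (F * G) =
      (X0 * pd0 F + X1 * pd1 F) * G + F * (X0 * pd0 G + X1 * pd1 G)"
    by (simp add: pd0_mult pd1_mult algebra_simps)
  also have "\<dots> = of_nat (e + f) * (F * G)"
    using assms by (simp add: binary_form_iff_euler algebra_simps)
  finally show ?thesis by (simp add: binary_form_iff_euler)
qed

lemma binary_form_transvectant:
  assumes "binary_form e E" "binary_form f F"
  shows "binary_form (e + f - 2 * r) (transvectant e f r E F)"
proof (cases "r \<le> min e f")
  case True
  have "binary_form (e + f - 2 * r)
      ((pd0 ^^ (r - i)) ((pd1 ^^ i) E) * (pd0 ^^ i) ((pd1 ^^ (r - i)) F))" if "i \<le> r" for i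
  proof -
    have "binary_form ((e - i - (r - i)) + (f - (r - i) - i))
        ((pd0 ^^ (r - i)) ((pd1 ^^ i) E) * (pd0 ^^ i) ((pd1 ^^ (r - i)) F))"
      using assms by (intro binary_form_mult binary_form_pd0_pow binary_form_pd1_pow)
    moreover have "(e - i - (r - i)) + (f - (r - i) - i) = e + f - 2 * r"
      using True that by auto
    ultimately show ?thesis by simp
  qed
  then show ?thesis
    unfolding transvectant_def
    by (auto intro!: binary_form_cscale binary_form_sum binary_form_0)
next
  case False
  then show ?thesis by (auto simp: transvectant_def binary_form_0)
qed

section \<open>Transvectants in terms of derivatives in one variable\<close>

text \<open>The \<open>Suc r\<close>-th finite difference is the \<open>r\<close>-th difference of the first difference. Both
  the recursion for powers of the Omega process and its counterpart in Cayley's formula have this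
  shape.\<close>

lemma alternating_binomial_sum_Suc:
  fixes g :: "nat \<Rightarrow> 'a::comm_ring_1"
  shows "(\<Sum>i\<le>Suc r. (-1) ^ i * of_nat (Suc r choose i) * g i) =
    (\<Sum>i\<le>r. (-1) ^ i * of_nat (r choose i) * (g i - g (Suc i)))"
proof -
  have "(\<Sum>i\<le>Suc r. (-1) ^ i * of_nat (Suc r choose i) * g i) =
      g 0 + (\<Sum>i\<le>r. (-1) ^ Suc i * of_nat (r choose Suc i) * g (Suc i))
        + (\<Sum>i\<le>r. (-1) ^ Suc i * of_nat (r choose i) * g (Suc i))"
    by (simp add: sum.atMost_Suc_shift sum.distrib[symmetric] algebra_simps del: sum.atMost_Suc)
  also have "g 0 + (\<Sum>i\<le>r. (-1) ^ Suc i * of_nat (r choose Suc i) * g (Suc i)) =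
      (\<Sum>i\<le>Suc r. (-1) ^ i * of_nat (r choose i) * g i)"
    by (simp only: sum.atMost_Suc_shift) simp
  also have "\<dots> = (\<Sum>i\<le>r. (-1) ^ i * of_nat (r choose i) * g i)"
    by (simp add: binomial_eq_0)
  finally show ?thesis
    by (simp add: sum.distrib[symmetric] algebra_simps sum_negf sum_subtractf)
qed

lemma alternating_binomial_sums:
  fixes g :: "nat \<Rightarrow> 'a::comm_ring_1"
  defines "S \<equiv> \<lambda>r. \<Sum>k\<le>r. (-1) ^ k * of_nat (r choose k) * g k"
  shows "S 1 = g 0 - g 1"
    and "S 2 = g 0 - 2 * g 1 + g 2"
    and "S 3 = g 0 - 3 * g 1 + 3 * g 2 - g 3"
    and "S 4 = g 0 - 4 * g 1 + 6 * g 2 - 4 * g 3 + g 4"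
    and "S 5 = g 0 - 5 * g 1 + 10 * g 2 - 10 * g 3 + 5 * g 4 - g 5"
    and "S 6 = g 0 - 6 * g 1 + 15 * g 2 - 20 * g 3 + 15 * g 4 - 6 * g 5 + g 6"
    and "S 7 = g 0 - 7 * g 1 + 21 * g 2 - 35 * g 3 + 35 * g 4 - 21 * g 5 + 7 * g 6 - g 7"
  unfolding S_def by (simp_all add: numeral_eq_Suc algebra_simps)

text \<open>The \<open>r\<close>-th power of Cayley's Omega process \<open>pd0 \<otimes> pd1 - pd1 \<otimes> pd0\<close>, that is, the
  transvectant without its factorials. It is defined whatever the orders of the forms are, which
  suits induction on \<open>r\<close>.\<close>

definition omega_pow :: "nat \<Rightarrow> bipoly \<Rightarrow> bipoly \<Rightarrow> bipoly" where
  "omega_pow r E F = (\<Sum>i\<le>r. (-1) ^ i * of_nat (r choose i) *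
     ((pd0 ^^ (r - i)) ((pd1 ^^ i) E) * (pd0 ^^ i) ((pd1 ^^ (r - i)) F)))"

lemma transvectant_omega_pow:
  assumes "r \<le> e" "r \<le> f"
  shows "transvectant e f r E F =
    cscale (fact (e - r) * fact (f - r) / (fact e * fact f)) (omega_pow r E F)"
proof -
  have "cscale ((-1) ^ i * of_nat n) G = (-1) ^ i * of_nat n * G" for i n G
    by (rule bipoly_eqI_ev) simp
  then show ?thesis using assms by (simp add: transvectant_def omega_pow_def)
qed

lemma omega_pow_Suc:
  "omega_pow (Suc r) E F = omega_pow r (pd0 E) (pd1 F) - omega_pow r (pd1 E) (pd0 F)"
proof -
  have "omega_pow (Suc r) E F = (\<Sum>i\<le>r. (-1) ^ i * of_nat (r choose i) *
     ((pd0 ^^ (Suc r - i)) ((pd1 ^^ i) E) * (pd0 ^^ i) ((pd1 ^^ (Suc r - i)) F)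
      - (pd0 ^^ (Suc r - Suc i)) ((pd1 ^^ Suc i) E) * (pd0 ^^ Suc i) ((pd1 ^^ (Suc r - Suc i)) F)))"
    unfolding omega_pow_def by (rule alternating_binomial_sum_Suc)
  also have "\<dots> = omega_pow r (pd0 E) (pd1 F) - omega_pow r (pd1 E) (pd0 F)"
    unfolding omega_pow_def sum_subtractf[symmetric]
    by (intro sum.cong refl)
       (simp add: Suc_diff_le funpow_swap1 pd1_pow_pd0 right_diff_distrib)
  finally show ?thesis .
qed

text \<open>Cayley's formula with its denominators cleared. In the induction step, Euler's relation
  for \<open>D^k G\<close> replaces \<open>x1 * D^k (pd1 G)\<close> by \<open>(m - k) * D^k G - x0 * D^(k+1) G\<close>. The two terms
  with \<open>x0\<close> are the same product \<open>x0 * D^(r+1-k) E * D^(k+1) F\<close> with opposite signs, and the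
  other two are consecutive values of the sequence \<open>g\<close>, so that the sum is an alternating binomial
  sum of the next order.\<close>

lemma X1_pow_omega_pow:
  assumes "binary_form e E" "binary_form f F" "r \<le> e" "r \<le> f"
  shows "fact (e - r) * fact (f - r) * (X1 ^ r * omega_pow r E F) =
    (\<Sum>k\<le>r. (-1) ^ k * of_nat (r choose k) *
       (fact (e - (r - k)) * fact (f - k) * ((pd0 ^^ (r - k)) E * (pd0 ^^ k) F)))"
  using assms
proof (induction r arbitrary: e f E F)
  case 0
  then show ?case by (simp add: omega_pow_def)
next
  case (Suc r)
  have forms: "binary_form (e - 1) (pd0 E)" "binary_form (e - 1) (pd1 E)"
    "binary_form (f - 1) (pd0 F)" "binary_form (f - 1) (pd1 F)"
    using Suc.prems by (auto intro: binary_form_pd0 binary_form_pd1 simp del: One_nat_def)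
  have le: "r \<le> e - 1" "r \<le> f - 1"
    using Suc.prems by simp_all
  define D where "D k G = (pd0 ^^ k) G" for k G
  define a b :: nat where "a = e - Suc r" and "b = f - Suc r"
  have ab: "e = a + Suc r" "f = b + Suc r" using Suc.prems by (simp_all add: a_def b_def)
  define g where "g k = fact (e - (Suc r - k)) * fact (f - k) * (D (Suc r - k) E * D k F)" for k
  have euler: "X1 * D k (pd1 G) = of_nat (m - k) * D k G - X0 * D (Suc k) G"
    if "binary_form m G" for m k G
    using binary_form_pd0_pow[OF that, of k]
    by (simp add: binary_form_iff_euler D_def pd0_pow_pd1 algebra_simps)
  have step: "X1 * (fact (a + k) * fact (b + (r - k)) *
       (D (r - k) (pd0 E) * D k (pd1 F) - D (r - k) (pd1 E) * D k (pd0 F))) = g k - g (Suc k)"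
    if k: "k \<le> r" for k
  proof -
    have s: "D j (pd0 G) = D (Suc j) G" for j G
      by (simp add: D_def funpow_swap1)
    have "X1 * (D (r - k) (pd0 E) * D k (pd1 F) - D (r - k) (pd1 E) * D k (pd0 F)) =
      D (Suc (r - k)) E * (X1 * D k (pd1 F)) - (X1 * D (r - k) (pd1 E)) * D (Suc k) F"
      by (simp add: s algebra_simps)
    also have "\<dots> = of_nat (f - k) * (D (Suc (r - k)) E * D k F)
        - of_nat (e - (r - k)) * (D (r - k) E * D (Suc k) F)"
      by (simp add: euler[OF Suc.prems(1)] euler[OF Suc.prems(2)] algebra_simps)
    finally have *: "X1 * (D (r - k) (pd0 E) * D k (pd1 F) - D (r - k) (pd1 E) * D k (pd0 F)) = \<dots>" .
    have n: "f - k = Suc (b + (r - k))" "e - (r - k) = Suc (a + k)" "e - Suc (r - k) = a + k"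
      "f - Suc k = b + (r - k)" "Suc r - k = Suc (r - k)"
      using k by (auto simp: ab)
    have "X1 * (fact (a + k) * fact (b + (r - k)) *
       (D (r - k) (pd0 E) * D k (pd1 F) - D (r - k) (pd1 E) * D k (pd0 F))) =
      fact (a + k) * fact (b + (r - k)) *
       (X1 * (D (r - k) (pd0 E) * D k (pd1 F) - D (r - k) (pd1 E) * D k (pd0 F)))"
      by (simp add: mult_ac)
    also have "\<dots> = g k - g (Suc k)"
      unfolding * g_def n diff_Suc_Suc fact_Suc by (simp add: algebra_simps del: of_nat_Suc)
    finally show ?thesis .
  qed
  have "fact (e - Suc r) * fact (f - Suc r) * (X1 ^ Suc r * omega_pow (Suc r) E F) =
    X1 * (fact (e - 1 - r) * fact (f - 1 - r) * (X1 ^ r * omega_pow r (pd0 E) (pd1 F))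
        - fact (e - 1 - r) * fact (f - 1 - r) * (X1 ^ r * omega_pow r (pd1 E) (pd0 F)))"
    by (simp add: omega_pow_Suc algebra_simps)
  also have "\<dots> = X1 * (\<Sum>k\<le>r. (-1) ^ k * of_nat (r choose k) *
       (fact (e - 1 - (r - k)) * fact (f - 1 - k) *
         (D (r - k) (pd0 E) * D k (pd1 F) - D (r - k) (pd1 E) * D k (pd0 F))))"
    unfolding Suc.IH[OF forms(1) forms(4) le] Suc.IH[OF forms(2) forms(3) le] D_def[symmetric]
    by (simp only: sum_subtractf[symmetric] right_diff_distrib)
  also have "\<dots> = (\<Sum>k\<le>r. (-1) ^ k * of_nat (r choose k) * (g k - g (Suc k)))"
    unfolding sum_distrib_left
  proof (rule sum.cong[OF refl])
    fix k assume "k \<in> {..r}"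
    then have k: "k \<le> r" by simp
    have "e - 1 - (r - k) = a + k" "f - 1 - k = b + (r - k)" using k by (auto simp: ab)
    then show "X1 * ((-1) ^ k * of_nat (r choose k) *
       (fact (e - 1 - (r - k)) * fact (f - 1 - k) *
         (D (r - k) (pd0 E) * D k (pd1 F) - D (r - k) (pd1 E) * D k (pd0 F)))) =
      (-1) ^ k * of_nat (r choose k) * (g k - g (Suc k))"
      by (simp only: step[OF k, symmetric]) (simp only: mult_ac)
  qed
  also have "\<dots> = (\<Sum>k\<le>Suc r. (-1) ^ k * of_nat (Suc r choose k) * g k)"
    by (rule alternating_binomial_sum_Suc[symmetric])
  finally show ?case unfolding g_def D_def .
qed

text \<open>The factor makes the transvectant formula free of orders: \<open>nder e k\<close> sends
  \<open>(e choose k) * x0^k * x1^(e-k)\<close> to \<open>x1^(e-k)\<close>.\<close>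

definition nder :: "nat \<Rightarrow> nat \<Rightarrow> bipoly \<Rightarrow> bipoly" where
  "nder e k F = cscale (fact (e - k) / fact e) ((pd0 ^^ k) F)"

lemma nder_0 [simp]: "nder e 0 F = F"
  by (simp add: nder_def)

lemma pd0_nder:
  assumes "k < e"
  shows "pd0 (nder e k F) = (of_nat e - of_nat k) * nder e (Suc k) F"
proof -
  have "e - k = Suc (e - Suc k)" using assms by simp
  then have "(fact (e - k) :: complex) = of_nat (e - k) * fact (e - Suc k)"
    by (metis fact_Suc)
  then have "pd0 (nder e k F) = cscale (of_nat (e - k)) (nder e (Suc k) F)"
    by (simp add: nder_def del: cscale_of_nat of_nat_diff)
  also have "\<dots> = (of_nat e - of_nat k) * nder e (Suc k) F"
    using of_nat_diff[of k e, where 'a = bipoly] assms by (metis cscale_of_nat less_imp_le)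
  finally show ?thesis .
qed

lemma X1_pow_transvectant:
  assumes "binary_form e E" "binary_form f F" "r \<le> e" "r \<le> f"
  shows "X1 ^ r * transvectant e f r E F =
    (\<Sum>k\<le>r. (-1) ^ k * of_nat (r choose k) * (nder e (r - k) E * nder f k F))"
proof (rule bipoly_eqI_ev)
  fix x y
  have fact_ev: "ev x y (fact n) = fact n" for n
    by (metis ev_ring(9) of_nat_fact)
  have "ev x y (X1 ^ r * transvectant e f r E F) =
     ev x y (fact (e - r) * fact (f - r) * (X1 ^ r * omega_pow r E F)) / (fact e * fact f)"
    by (simp add: transvectant_omega_pow assms fact_ev field_simps)
  also have "\<dots> = ev x y (\<Sum>k\<le>r. (-1) ^ k * of_nat (r choose k) * (nder e (r - k) E * nder f k F))"
    unfolding X1_pow_omega_pow[OF assms] ev_sum sum_divide_distrib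
    by (rule sum.cong) (simp_all add: nder_def fact_ev field_simps)
  finally show "ev x y (X1 ^ r * transvectant e f r E F) = \<dots>" .
qed

section \<open>The first transvectant of independent forms\<close>

text \<open>If both degrees are positive, the two sides have leading coefficients \<open>m * a * b\<close> and
  \<open>n * a * b\<close>, where \<open>m\<close>, \<open>n\<close> are the degrees and \<open>a\<close>, \<open>b\<close> the leading coefficients of \<open>p\<close>
  and \<open>q\<close>. If one of the polynomials is constant, the relation makes the derivative of the other
  zero.\<close>

lemma wronskian_zero_degree_eq:
  fixes p q :: "'a::{idom, ring_char_0} poly"
  assumes "pderiv p * q = p * pderiv q" "p \<noteq> 0" "q \<noteq> 0"
  shows "degree p = degree q"
proof -
  have lc: "pderiv h = 0 \<and> degree h = 0 \<or>
      lead_coeff (pderiv h) = of_nat (degree h) * lead_coeff h \<and> pderiv h \<noteq> 0"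
    for h :: "'a poly"
    by (cases "degree h") (simp_all add: degree_pderiv coeff_pderiv pderiv_eq_0_iff del: of_nat_Suc)
  have "lead_coeff (pderiv p) * lead_coeff q = lead_coeff p * lead_coeff (pderiv q)"
    using assms(1) by (metis lead_coeff_mult)
  then show ?thesis
    using lc[of p] lc[of q] assms by auto
qed

text \<open>Euler's relation turns the vanishing of the Jacobian into the vanishing of the Wronskian in
  \<open>x1\<close>, to which \<open>wronskian_zero_degree_eq\<close> applies: first to \<open>A\<close> and \<open>B\<close>, which therefore have
  the same degree, then to \<open>B\<close> and the combination of \<open>A\<close> and \<open>B\<close> without leading term.\<close>

lemma wronskian_nonzero:
  assumes "binary_form d A" "binary_form d B" "lin_indep_pair A B" "d > 0"
  shows "pd0 A * pd1 B - pd1 A * pd0 B \<noteq> 0"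
proof
  assume zero: "pd0 A * pd1 B - pd1 A * pd0 B = 0"
  have "of_nat d * (A * pd1 B - pd1 A * B) =
      (X0 * pd0 A + X1 * pd1 A) * pd1 B - pd1 A * (X0 * pd0 B + X1 * pd1 B)"
    using assms(1,2) by (simp add: binary_form_iff_euler algebra_simps)
  also have "\<dots> = X0 * (pd0 A * pd1 B - pd1 A * pd0 B)"
    by (simp add: algebra_simps)
  finally have eq: "pderiv A * B = A * pderiv B"
    using zero assms(4) by (simp add: pd1_def)
  have nz: "A \<noteq> 0" "B \<noteq> 0"
    using assms(3) unfolding lin_indep_pair_def
    by (metis add.right_neutral cscale_simps(1,3) zero_neq_one add.left_neutral)+
  define n where "n = degree A"
  have deg: "degree B = n"
    using wronskian_zero_degree_eq[OF eq nz] by (simp add: n_def)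
  define a b where "a = coeff (coeff A n) (d - n)" and "b = coeff (coeff B n) (d - n)"
  \<comment> \<open>The coefficients of a form are monomials in \<open>x0\<close>, so one scalar cancels the leading one.\<close>
  have lead: "coeff (coeff H n) i = (if i = d - n then coeff (coeff H n) (d - n) else 0)"
    if "binary_form d H" for H i
    using that unfolding binary_form_def by (metis add_diff_cancel_right')
  have "coeff B n \<noteq> 0" using nz deg by auto
  then have b: "b \<noteq> 0"
    using lead[OF assms(2)] unfolding b_def by (metis leading_coeff_0_iff)
  define C where "C = cscale b A + cscale (- a) B"
  have "C \<noteq> 0"
    using assms(3) b unfolding C_def lin_indep_pair_def by blast
  moreover have "pderiv C * B = C * pderiv B"
  proof -
    have "pderiv C * B = cscale b (pderiv A * B) + cscale (- a) (pderiv B * B)"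
      unfolding C_def by (simp add: pd1_def[symmetric] distrib_right cscale_mult)
    then show ?thesis
      by (simp add: C_def eq distrib_right cscale_mult mult.commute[of "pderiv B"])
  qed
  ultimately have "degree C = n"
    using wronskian_zero_degree_eq[of C B] nz deg by simp
  moreover have "coeff C n = 0"
  proof (rule poly_eqI)
    fix i
    have "coeff (coeff C n) i = b * coeff (coeff A n) i - a * coeff (coeff B n) i"
      by (simp add: C_def coeff_cscale)
    also have "\<dots> = 0"
      using lead[OF assms(1), of i] lead[OF assms(2), of i] by (simp add: a_def b_def)
    finally show "coeff (coeff C n) i = coeff 0 i" by simp
  qed
  ultimately show False
    using \<open>C \<noteq> 0\<close> by auto
qed

section \<open>Odd transvectants and their derivatives as combinations of brackets\<close>

text \<open>The Pluecker coordinates of the pair \<open>(A, B)\<close> of sequences of normalised derivatives.\<close>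

definition bracket :: "nat \<Rightarrow> bipoly \<Rightarrow> bipoly \<Rightarrow> nat \<Rightarrow> nat \<Rightarrow> bipoly" where
  "bracket d A B i j = nder d i A * nder d j B - nder d j A * nder d i B"

lemma bracket_self [simp]: "bracket d A B i i = 0"
  by (simp add: bracket_def mult.commute)

lemma pd0_bracket:
  assumes "i < d" "j < d"
  shows "pd0 (bracket d A B i j) =
    (of_nat d - of_nat i) * bracket d A B (i + 1) j + (of_nat d - of_nat j) * bracket d A B i (j + 1)"
  using assms by (simp add: bracket_def pd0_mult pd0_nder algebra_simps)

lemma bracket_pluecker:
  "bracket d A B j i * bracket d A B l k - bracket d A B k i * bracket d A B l j
     + bracket d A B l i * bracket d A B k j = 0"
  unfolding bracket_def by algebra

lemma odd_transvectants_bracket: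
  assumes "binary_form d A" "binary_form d B" "d \<ge> 7"
  defines "p \<equiv> bracket d A B"
  shows "X1 ^ 1 * transvectant d d 1 A B = p 1 0"
    and "X1 ^ 3 * transvectant d d 3 A B = p 3 0 - 3 * p 2 1"
    and "X1 ^ 5 * transvectant d d 5 A B = p 5 0 - 5 * p 4 1 + 10 * p 3 2"
    and "X1 ^ 7 * transvectant d d 7 A B = p 7 0 - 7 * p 6 1 + 21 * p 5 2 - 35 * p 4 3"
  unfolding p_def using assms(3)
  by (simp_all only: X1_pow_transvectant[OF assms(1,2)] alternating_binomial_sums)
     (simp_all add: bracket_def algebra_simps)

lemma pd0_X1_pow_nder:
  assumes "k < m"
  shows "pd0 (X1 ^ r * nder m k F) = (of_nat m - of_nat k) * (X1 ^ r * nder m (k + 1) F)"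
  using pd0_nder[OF assms] by (simp add: pd0_mult mult_ac)

text \<open>The sequences \<open>t\<close>, \<open>u\<close>, \<open>v\<close> below stand for \<open>x1^r * T_r[k]\<close> with \<open>r = 1, 3, 5\<close>. Each
  equation results from its predecessor by differentiation: on the left, the \<open>k\<close>-th
  term becomes \<open>2d - 2r - k\<close> times the next one, and on the right each bracket \<open>p i j\<close> becomes
  \<open>(d-i) * p (i+1) j + (d-j) * p i (j+1)\<close>. Every second time a factor \<open>d - i\<close> is common to both
  sides and can be cancelled, which keeps the denominators small.\<close>

context
  fixes d :: nat and p :: "nat \<Rightarrow> nat \<Rightarrow> bipoly" and \<delta> :: bipoly
  assumes d: "d \<ge> 7" and \<delta>: "\<delta> = of_nat d"
    and p_self [simp]: "\<And>i. p i i = 0"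
    and pd0_p: "\<forall>i<7. \<forall>j<7.
      pd0 (p i j) = (\<delta> - of_nat i) * p (i + 1) j + (\<delta> - of_nat j) * p i (j + 1)"
begin

lemma delta_neq: "\<delta> - 1 \<noteq> 0" "\<delta> - 2 \<noteq> 0" "\<delta> - 3 \<noteq> 0" "\<delta> - 4 \<noteq> 0" "\<delta> - 5 \<noteq> 0"
proof -
  have "\<delta> - of_nat k \<noteq> 0" if "k < 7" for k
    using that d unfolding \<delta> by (metis eq_iff_diff_eq_0 of_nat_eq_iff not_le)
  from this[of 1] this[of 2] this[of 3] this[of 4] this[of 5]
  show "\<delta> - 1 \<noteq> 0" "\<delta> - 2 \<noteq> 0" "\<delta> - 3 \<noteq> 0" "\<delta> - 4 \<noteq> 0" "\<delta> - 5 \<noteq> 0"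
    by simp_all
qed

lemma pd0_delta: "pd0 \<delta> = 0"
  by (simp add: \<delta>)

lemma derivatives_first_transvectant:
  assumes pd0_t: "\<forall>k<6. pd0 (t k) = (2 * \<delta> - 2 - of_nat k) * t (k + 1)"
    and t0: "t 0 = p 1 0"
  shows "2 * t 1 = p 2 0"
    and "2 * (2 * \<delta> - 3) * t 2 = (\<delta> - 2) * p 3 0 + \<delta> * p 2 1"
    and "4 * (2 * \<delta> - 3) * t 3 = (\<delta> - 3) * p 4 0 + 2 * \<delta> * p 3 1"
    and "4 * (2 * \<delta> - 3) * (2 * \<delta> - 5) * t 4 =
      (\<delta> - 3) * (\<delta> - 4) * p 5 0 + 3 * \<delta> * (\<delta> - 3) * p 4 1 + 2 * \<delta> * (\<delta> - 1) * p 3 2"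
    and "8 * (2 * \<delta> - 3) * (2 * \<delta> - 5) * t 5 =
      (\<delta> - 4) * (\<delta> - 5) * p 6 0 + 4 * \<delta> * (\<delta> - 4) * p 5 1 + 5 * \<delta> * (\<delta> - 1) * p 4 2"
    and "8 * (2 * \<delta> - 3) * (2 * \<delta> - 5) * (2 * \<delta> - 7) * t 6 =
      (\<delta> - 4) * (\<delta> - 5) * (\<delta> - 6) * p 7 0 + 5 * \<delta> * (\<delta> - 4) * (\<delta> - 5) * p 6 1
        + 9 * \<delta> * (\<delta> - 1) * (\<delta> - 4) * p 5 2 + 5 * \<delta> * (\<delta> - 1) * (\<delta> - 2) * p 4 3"
proof -
  note expand = pd0_delta pd0_t pd0_p pd0_mult algebra_simps
  have "(\<delta> - 1) * (2 * t 1) = (\<delta> - 1) * p 2 0"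
    using arg_cong[OF t0, of pd0] by (simp add: expand del: One_nat_def)
  then show t1: "2 * t 1 = p 2 0"
    using delta_neq mult_left_cancel by blast
  show t2: "2 * (2 * \<delta> - 3) * t 2 = (\<delta> - 2) * p 3 0 + \<delta> * p 2 1"
    using arg_cong[OF t1, of pd0] by (simp add: expand del: One_nat_def)
  have "(\<delta> - 2) * (4 * (2 * \<delta> - 3) * t 3) = (\<delta> - 2) * ((\<delta> - 3) * p 4 0 + 2 * \<delta> * p 3 1)"
    using arg_cong[OF t2, of pd0] by (simp add: expand del: One_nat_def)
  then show t3: "4 * (2 * \<delta> - 3) * t 3 = (\<delta> - 3) * p 4 0 + 2 * \<delta> * p 3 1"
    using delta_neq mult_left_cancel by blast
  show t4: "4 * (2 * \<delta> - 3) * (2 * \<delta> - 5) * t 4 =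
      (\<delta> - 3) * (\<delta> - 4) * p 5 0 + 3 * \<delta> * (\<delta> - 3) * p 4 1 + 2 * \<delta> * (\<delta> - 1) * p 3 2"
    using arg_cong[OF t3, of pd0] by (simp add: expand del: One_nat_def)
  have "(\<delta> - 3) * (8 * (2 * \<delta> - 3) * (2 * \<delta> - 5) * t 5) = (\<delta> - 3) *
      ((\<delta> - 4) * (\<delta> - 5) * p 6 0 + 4 * \<delta> * (\<delta> - 4) * p 5 1 + 5 * \<delta> * (\<delta> - 1) * p 4 2)"
    using arg_cong[OF t4, of pd0] by (simp add: expand del: One_nat_def)
  then show t5: "8 * (2 * \<delta> - 3) * (2 * \<delta> - 5) * t 5 =
      (\<delta> - 4) * (\<delta> - 5) * p 6 0 + 4 * \<delta> * (\<delta> - 4) * p 5 1 + 5 * \<delta> * (\<delta> - 1) * p 4 2"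
    using delta_neq mult_left_cancel by blast
  show "8 * (2 * \<delta> - 3) * (2 * \<delta> - 5) * (2 * \<delta> - 7) * t 6 =
      (\<delta> - 4) * (\<delta> - 5) * (\<delta> - 6) * p 7 0 + 5 * \<delta> * (\<delta> - 4) * (\<delta> - 5) * p 6 1
        + 9 * \<delta> * (\<delta> - 1) * (\<delta> - 4) * p 5 2 + 5 * \<delta> * (\<delta> - 1) * (\<delta> - 2) * p 4 3"
    using arg_cong[OF t5, of pd0] by (simp add: expand del: One_nat_def)
qed

lemma derivatives_third_transvectant:
  assumes pd0_u: "\<forall>k<4. pd0 (u k) = (2 * \<delta> - 6 - of_nat k) * u (k + 1)"
    and u0: "u 0 = p 3 0 - 3 * p 2 1"
  shows "2 * u 1 = p 4 0 - 2 * p 3 1"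
    and "2 * (2 * \<delta> - 7) * u 2 = (\<delta> - 4) * p 5 0 + (6 - \<delta>) * p 4 1 - 2 * (\<delta> - 1) * p 3 2"
    and "4 * (2 * \<delta> - 7) * u 3 = (\<delta> - 5) * p 6 0 + 6 * p 5 1 - 3 * (\<delta> - 1) * p 4 2"
    and "4 * (2 * \<delta> - 7) * (2 * \<delta> - 9) * u 4 =
      (\<delta> - 5) * (\<delta> - 6) * p 7 0 + (\<delta> - 5) * (\<delta> + 6) * p 6 1
        + (\<delta> - 1) * (18 - 3 * \<delta>) * p 5 2 - 3 * (\<delta> - 1) * (\<delta> - 2) * p 4 3"
proof -
  note expand = pd0_delta pd0_u pd0_p pd0_mult algebra_simps
  have "(\<delta> - 3) * (2 * u 1) = (\<delta> - 3) * (p 4 0 - 2 * p 3 1)"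
    using arg_cong[OF u0, of pd0] by (simp add: expand del: One_nat_def)
  then show u1: "2 * u 1 = p 4 0 - 2 * p 3 1"
    using delta_neq mult_left_cancel by blast
  show u2: "2 * (2 * \<delta> - 7) * u 2 =
      (\<delta> - 4) * p 5 0 + (6 - \<delta>) * p 4 1 - 2 * (\<delta> - 1) * p 3 2"
    using arg_cong[OF u1, of pd0] by (simp add: expand del: One_nat_def)
  have "(\<delta> - 4) * (4 * (2 * \<delta> - 7) * u 3) =
      (\<delta> - 4) * ((\<delta> - 5) * p 6 0 + 6 * p 5 1 - 3 * (\<delta> - 1) * p 4 2)"
    using arg_cong[OF u2, of pd0] by (simp add: expand del: One_nat_def)
  then show u3: "4 * (2 * \<delta> - 7) * u 3 = (\<delta> - 5) * p 6 0 + 6 * p 5 1 - 3 * (\<delta> - 1) * p 4 2"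
    using delta_neq mult_left_cancel by blast
  show "4 * (2 * \<delta> - 7) * (2 * \<delta> - 9) * u 4 =
      (\<delta> - 5) * (\<delta> - 6) * p 7 0 + (\<delta> - 5) * (\<delta> + 6) * p 6 1
        + (\<delta> - 1) * (18 - 3 * \<delta>) * p 5 2 - 3 * (\<delta> - 1) * (\<delta> - 2) * p 4 3"
    using arg_cong[OF u3, of pd0] by (simp add: expand del: One_nat_def)
qed

lemma derivatives_fifth_transvectant:
  assumes pd0_v: "\<forall>k<2. pd0 (v k) = (2 * \<delta> - 10 - of_nat k) * v (k + 1)"
    and v0: "v 0 = p 5 0 - 5 * p 4 1 + 10 * p 3 2"
  shows "2 * v 1 = p 6 0 - 4 * p 5 1 + 5 * p 4 2"
    and "2 * (2 * \<delta> - 11) * v 2 =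
      (\<delta> - 6) * p 7 0 + (20 - 3 * \<delta>) * p 6 1 + (\<delta> - 16) * p 5 2 + 5 * (\<delta> - 2) * p 4 3"
proof -
  note expand = pd0_delta pd0_v pd0_p pd0_mult algebra_simps
  have "(\<delta> - 5) * (2 * v 1) = (\<delta> - 5) * (p 6 0 - 4 * p 5 1 + 5 * p 4 2)"
    using arg_cong[OF v0, of pd0] by (simp add: expand del: One_nat_def)
  then show v1: "2 * v 1 = p 6 0 - 4 * p 5 1 + 5 * p 4 2"
    using delta_neq mult_left_cancel by blast
  show "2 * (2 * \<delta> - 11) * v 2 =
      (\<delta> - 6) * p 7 0 + (20 - 3 * \<delta>) * p 6 1 + (\<delta> - 16) * p 5 2 + 5 * (\<delta> - 2) * p 4 3"
    using arg_cong[OF v1, of pd0] by (simp add: expand del: One_nat_def)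
qed

end

text \<open>Powers of \<open>x1\<close> are constants for \<open>D\<close>, so Cayley's formula applies to \<open>x1^r * F\<close> and
  \<open>x1^s * G\<close> in place of \<open>F\<close> and \<open>G\<close>; for the forms \<open>T_r\<close> these are the combinations of
  brackets computed above.\<close>

lemma quadratic_transvectants:
  fixes r s :: nat
  assumes "binary_form m F" "binary_form n G" "k \<le> m" "k \<le> n"
  defines "f \<equiv> \<lambda>i. X1 ^ r * nder m i F" and "g \<equiv> \<lambda>i. X1 ^ s * nder n i G"
  shows "X1 ^ (r + s + k) * transvectant m n k F G =
    (\<Sum>i\<le>k. (-1) ^ i * of_nat (k choose i) * (f (k - i) * g i))"
  unfolding f_def g_def power_add mult.assoc X1_pow_transvectant[OF assms(1-4)] sum_distrib_left
  by (simp add: mult_ac)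

section \<open>The identity between products of brackets\<close>

text \<open>With \<open>t\<close>, \<open>u\<close>, \<open>v\<close> as above, the numerators of
  the \<open>\<beta>\<close> supply all factors \<open>2d - 5\<close> and \<open>2d - 7\<close> of the denominators, and
  \<open>d * (d-1) * (2d-3) * (2d-9) * (2d-11) * (4d-13)\<close> is a common denominator for the whole. The
  numerators \<open>C2, \<dots>, V2\<close> remain opaque, which keeps this step independent of the brackets.\<close>

lemma clear_denominators:
  fixes d :: complex
  assumes nz: "d \<noteq> 0" "d - 1 \<noteq> 0" "2*d-3\<noteq>0" "2*d-5 \<noteq> 0" "2*d-7\<noteq>0" "2*d-9\<noteq>0" "2*d-11\<noteq>0" "4*d-13\<noteq>0"
   and t: "2*t1 = p20" "2*(2*d-3)*t2 = C2" "4*(2*d-3)*t3 = C3" "4*(2*d-3)*(2*d-5)*t4=C4"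
     "8*(2*d-3)*(2*d-5)*t5=C5" "8*(2*d-3)*(2*d-5)*(2*d-7)*t6=C6"
   and u: "2*u1=U1" "2*(2*d-7)*u2=U2" "4*(2*d-7)*u3=U3" "4*(2*d-7)*(2*d-9)*u4=U4"
   and v: "2*v1=V1" "2*(2*d-11)*v2=V2"
   and main: "(d-5)*(d-6)*(2*d-3)^2*(2*d-5)*(4*d-13)*(t0*w0) =
       - 2*(2*d-3)*(2*d-9)*(2*d-11)*(t0*C6) + 6*(2*d-3)*(2*d-7)*(2*d-9)*(2*d-11)*(p20*C5)
       - 30*(2*d-7)*(2*d-9)*(2*d-11)*(C2*C4) + 10*(2*d-5)*(2*d-7)*(2*d-9)*(2*d-11)*C3^2
       - 15*(2*d-7)*(2*d-9)*(2*d-11)*(C4*u0) + 30*(2*d-5)*(2*d-7)*(2*d-9)*(2*d-11)*(C3*U1)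
       - 90*(2*d-5)*(2*d-9)*(2*d-11)*(C2*U2) + 30*(2*d-3)*(2*d-5)*(2*d-9)*(2*d-11)*(p20*U3)
       - 15*(2*d-3)*(2*d-5)*(2*d-11)*(t0*U4)
       + 6*(d-1)*(d-5)*(2*d-3)*(2*d-9)*(2*d-11)*(C2*v0) - 6*(d-1)*(d-5)*(2*d-3)^2*(2*d-9)*(2*d-11)*(p20*V1)
       + 6*(d-1)*(d-5)*(2*d-3)^2*(2*d-9)*(t0*V2)
       + 20*d*(d-3)*(2*d-5)*(2*d-9)*(2*d-11)*(u0*U2) - 10*d*(d-3)*(2*d-5)*(2*d-7)*(2*d-9)*(2*d-11)*U1^2
       + d*(d-1)*(2*d-3)*(4*d-13)*(2*d-9)*(2*d-11)*(u0*v0)"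
  shows "beta6 d * (t0 * w0) = beta1 d * (2*t0*t6-12*t1*t5+30*t2*t4-20*t3^2) + beta2 d * (t4*u0-4*t3*u1+6*t2*u2-4*t1*u3+t0*u4)
   + beta3 d * (t2*v0-2*t1*v1+t0*v2) + beta4 d*(2*u0*u2-2*u1^2) + beta5 d * (u0*v0)" (is "?l = ?r")
proof -
  \<comment> \<open>Naming the linear factors prevents the simplifier from multiplying them out.\<close>
  define a where "a = d - 1"
  define b c e f g h where b: "b = 2*d-3" "c = 2*d-5" "e = 2*d-7" "f = 2*d-9" "g = 2*d-11" "h=4*d-13"
  define x5 x6 x3 where x: "x5 = d-5" "x6 = d-6" "x3=d-3"
  define M where "M = d*a*b*f*g*h"
  have nz': "d\<noteq>0" "a\<noteq>0" "b\<noteq>0" "c\<noteq>0" "e\<noteq>0" "f\<noteq>0" "g\<noteq>0" "h\<noteq>0" using nz by (auto simp: a_def b)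
  have "M * ?l = x5*x6*b^2*c*h*(t0*w0)"
    unfolding beta6_def a_def[symmetric] b[symmetric] x[symmetric] M_def
    using nz' by (simp add: field_simps power2_eq_square)
  moreover have "M * (beta1 d * (2*t0*t6-12*t1*t5+30*t2*t4-20*t3^2)) =
    -2*b*f*g*(t0*C6) + 6*b*e*f*g*(p20*C5)- 30*e*f*g*(C2*C4) + 10*c*e*f*g*C3^2"
    unfolding beta1_def t[symmetric] a_def[symmetric] b[symmetric] x[symmetric] M_def
    using nz' by (simp add: field_simps power2_eq_square)
  moreover have "M * (beta2 d * (t4*u0-4*t3*u1+6*t2*u2-4*t1*u3+t0*u4)) =
     - 15*e*f*g*(C4*u0) + 30*c*e*f*g*(C3*U1)
       - 90*c*f*g*(C2*U2) + 30*b*c*f*g*(p20*U3)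
       - 15*b*c*g*(t0*U4)"
    unfolding beta2_def t[symmetric] u[symmetric] a_def[symmetric] b[symmetric] x[symmetric] M_def
    using nz' by (simp add: field_simps power2_eq_square)
  moreover have "M * (beta3 d * (t2*v0-2*t1*v1+t0*v2)) =
     6*a*x5*b*f*g*(C2*v0) - 6*a*x5*b^2*f*g*(p20*V1)
       + 6*a*x5*b^2*f*(t0*V2)"
    unfolding beta3_def t[symmetric] v[symmetric] a_def[symmetric] b[symmetric] x[symmetric] M_def
    using nz' by (simp add: field_simps power2_eq_square)
  moreover have "M * (beta4 d*(2*u0*u2-2*u1^2)) = 20*d*x3*c*f*g*(u0*U2) - 10*d*x3*c*e*f*g*U1^2"
    unfolding beta4_def u[symmetric] a_def[symmetric] b[symmetric] x[symmetric] M_def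
    using nz' by (simp add: field_simps power2_eq_square)
  moreover have "M * (beta5 d * (u0*v0)) = d*a*b*h*f*g*(u0*v0)"
    by (simp add: beta5_def M_def)
  moreover note main[folded a_def b x]
  ultimately have "M * ?l = M * ?r" by (simp only: distrib_left) (simp add: algebra_simps)
  moreover have "M \<noteq> 0" using nz' by (simp add: M_def)
  ultimately show ?thesis by simp
qed

text \<open>The difference of the two sides, as a polynomial in the independent variables
  \<open>p i j\<close>, is a combination of the two Pluecker relations.\<close>

lemma bracket_identity:
  fixes d :: complex
  assumes pl1: "p10*p52 - p20*p51 + p50*p21 = 0" and pl2: "p10*p43 - p30*p41 + p40*p31 = 0"
  assumes C: "C2 = (d-2)*p30+d*p21" "C3 = (d-3)*p40+2*d*p31"
    "C4 = (d-3)*(d-4)*p50+3*d*(d-3)*p41+2*d*(d-1)*p32"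
    "C5 = (d-4)*(d-5)*p60+4*d*(d-4)*p51+5*d*(d-1)*p42"
    "C6 = (d-4)*(d-5)*(d-6)*p70+5*d*(d-4)*(d-5)*p61+9*d*(d-1)*(d-4)*p52+5*d*(d-1)*(d-2)*p43"
   and u: "u0 = p30-3*p21" "U1 = p40-2*p31" "U2 = (d-4)*p50 +(6-d)*p41 - 2*(d-1)*p32"
     "U3 = (d-5)*p60+6*p51-3*(d-1)*p42"
     "U4 = (d-5)*(d-6)*p70+(d-5)*(d+6)*p61+(d-1)*(18-3*d)*p52-3*(d-1)*(d-2)*p43"
   and v: "v0=p50-5*p41+10*p32" "V1=p60-4*p51+5*p42"
     "V2=(d-6)*p70+(20-3*d)*p61+(d-16)*p52+5*(d-2)*p43"
   and w: "w0 = p70-7*p61+21*p52-35*p43"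
  shows "(d-5)*(d-6)*(2*d-3)^2*(2*d-5)*(4*d-13)*(p10*w0) =
       - 2*(2*d-3)*(2*d-9)*(2*d-11)*(p10*C6) + 6*(2*d-3)*(2*d-7)*(2*d-9)*(2*d-11)*(p20*C5)
       - 30*(2*d-7)*(2*d-9)*(2*d-11)*(C2*C4) + 10*(2*d-5)*(2*d-7)*(2*d-9)*(2*d-11)*C3^2
       - 15*(2*d-7)*(2*d-9)*(2*d-11)*(C4*u0) + 30*(2*d-5)*(2*d-7)*(2*d-9)*(2*d-11)*(C3*U1)
       - 90*(2*d-5)*(2*d-9)*(2*d-11)*(C2*U2) + 30*(2*d-3)*(2*d-5)*(2*d-9)*(2*d-11)*(p20*U3)
       - 15*(2*d-3)*(2*d-5)*(2*d-11)*(p10*U4)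
       + 6*(d-1)*(d-5)*(2*d-3)*(2*d-9)*(2*d-11)*(C2*v0) - 6*(d-1)*(d-5)*(2*d-3)^2*(2*d-9)*(2*d-11)*(p20*V1)
       + 6*(d-1)*(d-5)*(2*d-3)^2*(2*d-9)*(p10*V2)
       + 20*d*(d-3)*(2*d-5)*(2*d-9)*(2*d-11)*(u0*U2) - 10*d*(d-3)*(2*d-5)*(2*d-7)*(2*d-9)*(2*d-11)*U1^2
       + d*(d-1)*(2*d-3)*(4*d-13)*(2*d-9)*(2*d-11)*(u0*v0)" (is "?l = ?r")
proof -
  \<comment> \<open>\<open>p10 * p52\<close> occurs in the first relation only and \<open>p10 * p43\<close> in the second only, so the
    multipliers are the coefficients of these two products in the difference of the sides.\<close>
  define L1 where "L1 = 21*(d-5)*(d-6)*(2*d-3)^2*(2*d-5)*(4*d-13) + 18*d*(d-1)*(d-4)*(2*d-3)*(2*d-9)*(2*d-11)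
     + 15*(2*d-3)*(2*d-5)*(2*d-11)*(d-1)*(18-3*d) - 6*(d-1)*(d-5)*(2*d-3)^2*(2*d-9)*(d-16)"
  define L2 where "L2 = -35*(d-5)*(d-6)*(2*d-3)^2*(2*d-5)*(4*d-13) + 10*d*(d-1)*(d-2)*(2*d-3)*(2*d-9)*(2*d-11)
     - 45*(2*d-3)*(2*d-5)*(2*d-11)*(d-1)*(d-2) - 30*(d-1)*(d-5)*(2*d-3)^2*(2*d-9)*(d-2)"
  have "?l - ?r = L1 * (p10*p52 - p20*p51 + p50*p21) + L2 * (p10*p43 - p30*p41 + p40*p31)"
    unfolding L1_def L2_def C u v w by algebra
  then show ?thesis using pl1 pl2 by simp
qed

lemma jet_identity:
  fixes d :: complex and t u v :: "nat \<Rightarrow> complex" and p :: "nat \<Rightarrow> nat \<Rightarrow> complex"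
  assumes "d \<noteq> 0" "d - 1 \<noteq> 0" "2*d - 3 \<noteq> 0" "2*d - 5 \<noteq> 0" "2*d - 7 \<noteq> 0" "2*d - 9 \<noteq> 0"
      "2*d - 11 \<noteq> 0" "4*d - 13 \<noteq> 0"
    and pluecker: "p 1 0 * p 5 2 - p 2 0 * p 5 1 + p 5 0 * p 2 1 = 0"
      "p 1 0 * p 4 3 - p 3 0 * p 4 1 + p 4 0 * p 3 1 = 0"
    and t0: "t 0 = p 1 0" and u0: "u 0 = p 3 0 - 3 * p 2 1"
    and v0: "v 0 = p 5 0 - 5 * p 4 1 + 10 * p 3 2"
    and w0: "w = p 7 0 - 7 * p 6 1 + 21 * p 5 2 - 35 * p 4 3"
    and "2 * t 1 = p 2 0"
      "2 * (2*d - 3) * t 2 = (d - 2) * p 3 0 + d * p 2 1"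
      "4 * (2*d - 3) * t 3 = (d - 3) * p 4 0 + 2 * d * p 3 1"
      "4 * (2*d - 3) * (2*d - 5) * t 4 =
        (d - 3) * (d - 4) * p 5 0 + 3 * d * (d - 3) * p 4 1 + 2 * d * (d - 1) * p 3 2"
      "8 * (2*d - 3) * (2*d - 5) * t 5 =
        (d - 4) * (d - 5) * p 6 0 + 4 * d * (d - 4) * p 5 1 + 5 * d * (d - 1) * p 4 2"
      "8 * (2*d - 3) * (2*d - 5) * (2*d - 7) * t 6 =
        (d - 4) * (d - 5) * (d - 6) * p 7 0 + 5 * d * (d - 4) * (d - 5) * p 6 1
          + 9 * d * (d - 1) * (d - 4) * p 5 2 + 5 * d * (d - 1) * (d - 2) * p 4 3"
    and "2 * u 1 = p 4 0 - 2 * p 3 1"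
      "2 * (2*d - 7) * u 2 = (d - 4) * p 5 0 + (6 - d) * p 4 1 - 2 * (d - 1) * p 3 2"
      "4 * (2*d - 7) * u 3 = (d - 5) * p 6 0 + 6 * p 5 1 - 3 * (d - 1) * p 4 2"
      "4 * (2*d - 7) * (2*d - 9) * u 4 =
        (d - 5) * (d - 6) * p 7 0 + (d - 5) * (d + 6) * p 6 1
          + (d - 1) * (18 - 3 * d) * p 5 2 - 3 * (d - 1) * (d - 2) * p 4 3"
    and "2 * v 1 = p 6 0 - 4 * p 5 1 + 5 * p 4 2"
      "2 * (2*d - 11) * v 2 =
        (d - 6) * p 7 0 + (20 - 3 * d) * p 6 1 + (d - 16) * p 5 2 + 5 * (d - 2) * p 4 3"
  shows "beta6 d * (t 0 * w) =
      beta1 d * (2 * t 0 * t 6 - 12 * t 1 * t 5 + 30 * t 2 * t 4 - 20 * t 3 ^ 2)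
    + beta2 d * (t 4 * u 0 - 4 * t 3 * u 1 + 6 * t 2 * u 2 - 4 * t 1 * u 3 + t 0 * u 4)
    + beta3 d * (t 2 * v 0 - 2 * t 1 * v 1 + t 0 * v 2)
    + beta4 d * (2 * u 0 * u 2 - 2 * u 1 ^ 2)
    + beta5 d * (u 0 * v 0)"
  by (rule clear_denominators[OF assms(1-8) assms(15-26)], unfold t0,
      rule bracket_identity[OF pluecker refl refl refl refl refl u0 refl refl refl refl v0 refl refl w0])

section \<open>The seventh transvectant\<close>

theorem theorem5p6:
  fixes d :: nat and A B :: bipoly
  assumes "d \<ge> 7"
    and "binary_form d A" and "binary_form d B"
    and "lin_indep_pair A B"
  shows "let T = (\<lambda>i. transvectant d d i A B);
             ord = (\<lambda>i. 2 * d - 2 * i);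
             \<delta> = of_nat d;
             TT = (\<lambda>i j r. to_fract (transvectant (ord i) (ord j) r (T i) (T j)))
         in T 1 \<noteq> 0 \<and>
            to_fract (T 7) = 1 / to_fract (T 1) *
              (const_fract (beta1 \<delta> / beta6 \<delta>) * TT 1 1 6
             + const_fract (beta2 \<delta> / beta6 \<delta>) * TT 1 3 4
             + const_fract (beta3 \<delta> / beta6 \<delta>) * TT 1 5 2
             + const_fract (beta4 \<delta> / beta6 \<delta>) * TT 3 3 2
             + const_fract (beta5 \<delta> / beta6 \<delta>) * to_fract (T 3) * to_fract (T 5))"
proof -
  define T where "T i = transvectant d d i A B" for i
  define ord where "ord = (\<lambda>i. 2 * d - 2 * i)"
  define \<delta> :: complex where "\<delta> = of_nat d"
  define Q where "Q = (\<lambda>i j r. transvectant (ord i) (ord j) r (T i) (T j))"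
  define p where "p = bracket d A B"
  \<comment> \<open>Each \<open>T r\<close> needs the factor \<open>X1 ^ r\<close> and a further \<open>k\<close>-th transvectant the factor \<open>X1 ^ k\<close>;
    in every term of the identity these exponents add up to 8.\<close>
  define j where "j r k = X1 ^ r * nder (ord r) k (T r)" for r k

  have form_T: "binary_form (ord i) (T i)" for i
    using binary_form_transvectant[OF assms(2,3), of i] by (simp add: T_def ord_def mult_2)
  note j0 = odd_transvectants_bracket[OF assms(2,3,1), folded p_def T_def]
  have dj: "pd0 (j r k) = (2 * of_nat d - of_nat (2 * r) - of_nat k) * j r (k + 1)"
    if "k < ord r" "r \<le> d" for r k
    using pd0_X1_pow_nder[OF that(1), of r "T r"] that(2)
    by (simp add: j_def ord_def of_nat_diff)
  have dp: "\<forall>i<7. \<forall>j<7.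
      pd0 (p i j) = (of_nat d - of_nat i) * p (i + 1) j + (of_nat d - of_nat j) * p i (j + 1)"
    using assms(1) by (simp add: p_def pd0_bracket)
  have pself: "p i i = 0" for i by (simp add: p_def)

  have dj1: "\<forall>k<6. pd0 (j 1 k) = (2 * of_nat d - 2 - of_nat k) * j 1 (k + 1)"
    using dj[of _ 1] assms(1) by (simp add: ord_def)
  have dj3: "\<forall>k<4. pd0 (j 3 k) = (2 * of_nat d - 6 - of_nat k) * j 3 (k + 1)"
    using dj[of _ 3] assms(1) by (simp add: ord_def)
  have dj5: "\<forall>k<2. pd0 (j 5 k) = (2 * of_nat d - 10 - of_nat k) * j 5 (k + 1)"
    using dj[of _ 5] assms(1) by (simp add: ord_def)
  have j_0: "j 1 0 = p 1 0" "j 3 0 = p 3 0 - 3 * p 2 1" "j 5 0 = p 5 0 - 5 * p 4 1 + 10 * p 3 2"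
    using j0 by (simp_all add: j_def)
  note pluecker = bracket_pluecker[of d A B 1 0 5 2, folded p_def]
    bracket_pluecker[of d A B 1 0 4 3, folded p_def]
  note jets =
    derivatives_first_transvectant[OF assms(1) refl pself dp dj1 j_0(1)]
    derivatives_third_transvectant[OF assms(1) refl pself dp dj3 j_0(2)]
    derivatives_fifth_transvectant[OF assms(1) refl pself dp dj5 j_0(3)]

  have quadratic: "X1 ^ (r + s + k) * Q r s k =
      (\<Sum>i\<le>k. (-1) ^ i * of_nat (k choose i) * (j r (k - i) * j s i))"
    if "k \<le> ord r" "k \<le> ord s" for r s k
    unfolding Q_def j_def by (rule quadratic_transvectants[OF form_T form_T that])
  have Q116: "X1 ^ 8 * Q 1 1 6 =
      2 * j 1 0 * j 1 6 - 12 * j 1 1 * j 1 5 + 30 * j 1 2 * j 1 4 - 20 * j 1 3 ^ 2"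
    using quadratic[of 6 1 1] assms(1)
    by (simp only: alternating_binomial_sums)
       (simp add: ord_def algebra_simps power2_eq_square flip: One_nat_def)
  have Q134: "X1 ^ 8 * Q 1 3 4 =
      j 1 4 * j 3 0 - 4 * j 1 3 * j 3 1 + 6 * j 1 2 * j 3 2
        - 4 * j 1 1 * j 3 3 + j 1 0 * j 3 4"
    using quadratic[of 4 1 3] assms(1)
    by (simp only: alternating_binomial_sums)
       (simp add: ord_def algebra_simps power2_eq_square flip: One_nat_def)
  have Q152: "X1 ^ 8 * Q 1 5 2 = j 1 2 * j 5 0 - 2 * j 1 1 * j 5 1 + j 1 0 * j 5 2"
    using quadratic[of 2 1 5] assms(1)
    by (simp only: alternating_binomial_sums)
       (simp add: ord_def algebra_simps power2_eq_square flip: One_nat_def)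
  have Q332: "X1 ^ 8 * Q 3 3 2 = 2 * j 3 0 * j 3 2 - 2 * j 3 1 ^ 2"
    using quadratic[of 2 3 3] assms(1)
    by (simp only: alternating_binomial_sums)
       (simp add: ord_def algebra_simps power2_eq_square flip: One_nat_def)
  have P17: "X1 ^ 8 * (T 1 * T 7) = j 1 0 * (X1 ^ 7 * T 7)"
    and P35: "X1 ^ 8 * (T 3 * T 5) = j 3 0 * j 5 0"
    by (simp_all add: j_def eval_nat_numeral mult_ac)

  have nz: "\<delta> \<noteq> 0" "\<delta> - 1 \<noteq> 0" "2 * \<delta> - 3 \<noteq> 0" "2 * \<delta> - 5 \<noteq> 0" "2 * \<delta> - 7 \<noteq> 0"
     "2 * \<delta> - 9 \<noteq> 0" "2 * \<delta> - 11 \<noteq> 0" "4 * \<delta> - 13 \<noteq> 0" "\<delta> - 5 \<noteq> 0" "\<delta> - 6 \<noteq> 0"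
  proof -
    have "of_nat m * \<delta> - of_nat n \<noteq> 0" if "m * d \<noteq> n" for m n
      unfolding \<delta>_def using that by (metis eq_iff_diff_eq_0 of_nat_eq_iff of_nat_mult)
    from this[of 1 0] this[of 1 1] this[of 2 3] this[of 2 5] this[of 2 7]
      this[of 2 9] this[of 2 11] this[of 4 13] this[of 1 5] this[of 1 6]
    show "\<delta> \<noteq> 0" "\<delta> - 1 \<noteq> 0" "2 * \<delta> - 3 \<noteq> 0" "2 * \<delta> - 5 \<noteq> 0" "2 * \<delta> - 7 \<noteq> 0"
     "2 * \<delta> - 9 \<noteq> 0" "2 * \<delta> - 11 \<noteq> 0" "4 * \<delta> - 13 \<noteq> 0" "\<delta> - 5 \<noteq> 0" "\<delta> - 6 \<noteq> 0"
      using assms(1) by simp_all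
  qed
  then have beta6: "beta6 \<delta> \<noteq> 0"
    by (simp add: beta6_def)

  define R where "R = cscale (beta1 \<delta> / beta6 \<delta>) (Q 1 1 6) + cscale (beta2 \<delta> / beta6 \<delta>) (Q 1 3 4)
    + cscale (beta3 \<delta> / beta6 \<delta>) (Q 1 5 2) + cscale (beta4 \<delta> / beta6 \<delta>) (Q 3 3 2)
    + cscale (beta5 \<delta> / beta6 \<delta>) (T 3 * T 5)"
  have "X1 ^ 8 * (T 1 * T 7) = X1 ^ 8 * R"
  proof (rule bipoly_eqI_ev)
    fix x y
    let ?e = "ev x y"
    note ev_simps = ev_ring \<delta>_def[symmetric]
    have "beta6 \<delta> * (?e (j 1 0) * ?e (X1 ^ 7 * T 7)) =
        beta1 \<delta> * ?e (X1 ^ 8 * Q 1 1 6) + beta2 \<delta> * ?e (X1 ^ 8 * Q 1 3 4)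
      + beta3 \<delta> * ?e (X1 ^ 8 * Q 1 5 2) + beta4 \<delta> * ?e (X1 ^ 8 * Q 3 3 2)
      + beta5 \<delta> * ?e (X1 ^ 8 * (T 3 * T 5))"
      unfolding Q116 Q134 Q152 Q332 P35 unfolding ev_ring
      by (rule jet_identity[where t = "\<lambda>k. ?e (j 1 k)" and u = "\<lambda>k. ?e (j 3 k)"
          and v = "\<lambda>k. ?e (j 5 k)" and p = "\<lambda>a b. ?e (p a b)", OF nz(1-8)
          pluecker[THEN arg_cong[where f = ?e], unfolded ev_simps]
          j_0[THEN arg_cong[where f = ?e], unfolded ev_simps]
          j0(4)[THEN arg_cong[where f = ?e], unfolded ev_simps]
          jets[THEN arg_cong[where f = ?e], unfolded ev_simps]])
    also have "\<dots> = beta6 \<delta> * ?e (X1 ^ 8 * R)"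
      using beta6 by (simp add: R_def field_simps)
    finally show "?e (X1 ^ 8 * (T 1 * T 7)) = ?e (X1 ^ 8 * R)"
      unfolding P17 using beta6 by simp
  qed
  then have TR: "T 1 * T 7 = R"
    using X1_nonzero by simp
  have T1: "T 1 \<noteq> 0"
  proof -
    have "omega_pow 1 A B \<noteq> 0"
      using wronskian_nonzero[OF assms(2-4)] assms(1) by (simp add: omega_pow_def)
    then show ?thesis
      using assms(1) by (simp add: T_def transvectant_omega_pow cscale_def)
  qed
  have cscale_fract: "to_fract (cscale c F) = const_fract c * to_fract F" for c F
    by (simp add: cscale_def const_fract_def flip: to_fract_mult)
  have "to_fract (T 1) * to_fract (T 7) = to_fract R"
    by (simp flip: TR)
  then have "to_fract (T 7) = 1 / to_fract (T 1) * to_fract R"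
    using T1 by (simp add: field_simps)
  with T1 show ?thesis
    by (simp add: R_def cscale_fract Let_def T_def[symmetric] \<delta>_def[symmetric] Q_def ord_def mult.assoc)
qed

end
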